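(* Let $\{r_n\}_{n\ge1}$ be a nonnegative stochastic process adapted to a filtration $\{\mathcal F_n\}$ and let $\theta\in(0,1)$ be a constant. Suppose that $$\mathbb E[r_{n+2}\mid\mathcal F_{n+1}]\le(1+\theta)r_{n+1}-\theta r_n,\qquad n\ge1.$$ Then $r_n$ converges almost surely to some finite random variable $r_\infty$.
   Context: All random variables are real-valued and live on a common probability space; inequalities between random variables hold almost surely. *)

theory Defs
  imports "HOL-Probability.Probability"
begin

text \<open>
  Conditional expectations of nonnegative random variables are taken with
  \<^const>\<open>nn_cond_exp\<close>, so no integrability of the process is assumed and the value may be
  infinite.  (\<^const>\<open>real_cond_exp\<close> would not do: for a non-integrable nonnegative variable it
  replaces the value infinity by 0.)  Comparisons with a real bound of arbitrary sign are made
  in \<^typ>\<open>ereal\<close> via \<^const>\<open>enn2ereal\<close>; comparing in \<^typ>\<open>ennreal\<close> would truncate a negative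
  bound to 0.
\<close>

end

theory Submission
  imports Defs
begin

text \<open>
  The hypothesis says that \<open>V n = r (n + 1) - \<theta> r n\<close> is a supermartingale.  It is nonnegative:
  where \<open>V n < 0\<close>, the mean of \<open>r\<close> would decrease by a fixed amount at each later step and
  eventually be negative.  Restricted to the events \<open>r 1, r 2 \<le> K\<close>, which exhaust the space, \<open>V\<close> is
  integrable, so it converges by Doob's theorem; then so does the solution \<open>r\<close> of
  \<open>r (n + 1) = \<theta> r n + V n\<close>, because \<open>\<theta> < 1\<close>.
\<close>

section \<open>Upcrossings of a real sequence\<close>

text \<open>
  The gambler of Doob's argument: \<open>holding a b X n\<close> says that after time \<open>n\<close> one unit is held,
  bought as soon as the price falls below \<open>a\<close> and sold as soon as it exceeds \<open>b\<close>.
\<close>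

primrec holding :: "real \<Rightarrow> real \<Rightarrow> (nat \<Rightarrow> real) \<Rightarrow> nat \<Rightarrow> bool" where
  "holding a b X 0 \<longleftrightarrow> X 0 < a"
| "holding a b X (Suc n) \<longleftrightarrow> (if holding a b X n then X (Suc n) \<le> b else X (Suc n) < a)"

definition upcrossings :: "real \<Rightarrow> real \<Rightarrow> (nat \<Rightarrow> real) \<Rightarrow> nat \<Rightarrow> nat" where
  "upcrossings a b X n = (\<Sum>i<n. if holding a b X i \<and> b < X (Suc i) then 1 else 0)"

text \<open>The martingale transform of \<open>X\<close> by the strategy \<open>holding\<close>: the
  profit of the gambler with an open position valued at the current price.\<close>

definition gain :: "real \<Rightarrow> real \<Rightarrow> (nat \<Rightarrow> real) \<Rightarrow> nat \<Rightarrow> real" where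
  "gain a b X n = (\<Sum>i<n. if holding a b X i then X (Suc i) - X i else 0)"

text \<open>Every completed trade buys below \<open>a\<close> and sells above \<open>b\<close>. The
  extra summand is the open position, whose purchase price was below \<open>a\<close>; carrying it
  along makes the induction go through.\<close>

lemma gain_ge:
  assumes "a < b"
  shows "(b - a) * real (upcrossings a b X n) + (if holding a b X n then X n - a else 0)
    \<le> gain a b X n"
  using assms by (induction n) (auto simp: upcrossings_def gain_def algebra_simps)

lemma holding_if_less:
  assumes "a < b" "X n < a"
  shows "holding a b X n"
  using assms by (cases n) auto

lemma mono_upcrossings: "mono (upcrossings a b X)"
  unfolding mono_iff_le_Suc by (simp add: upcrossings_def)

text \<open>A bounded monotone count is eventually constant, so sales stop. A unit bought at the
  next price below \<open>a\<close> is then held forever, against a later price above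
  \<open>b\<close>.\<close>

lemma upcrossings_unbounded:
  assumes "a < b" and low: "\<exists>\<^sub>F n in sequentially. X n < a"
    and high: "\<exists>\<^sub>F n in sequentially. b < X n"
  shows "\<exists>n. N < upcrossings a b X n"
proof (rule ccontr)
  assume "\<not> ?thesis"
  then have bd: "upcrossings a b X n \<le> N" for n
    by (simp add: not_less)
  have fin: "finite (range (upcrossings a b X))"
    by (rule finite_subset[of _ "{..N}"]) (auto simp: bd)
  then have "Max (range (upcrossings a b X)) \<in> range (upcrossings a b X)"
    by (intro Max_in) auto
  then obtain n0 where n0: "Max (range (upcrossings a b X)) = upcrossings a b X n0"
    by auto
  have const: "upcrossings a b X n = upcrossings a b X n0" if "n0 \<le> n" for n
  proof (rule antisym)
    show "upcrossings a b X n \<le> upcrossings a b X n0"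
      unfolding n0[symmetric] using fin by (intro Max_ge) auto
    show "upcrossings a b X n0 \<le> upcrossings a b X n"
      using monoD[OF mono_upcrossings that] .
  qed
  obtain m where m: "n0 \<le> m" "X m < a"
    using low by (auto simp: frequently_sequentially)
  have no_sale: "X (Suc n) \<le> b" if "m \<le> n" "holding a b X n" for n
  proof (rule ccontr)
    assume "\<not> ?thesis"
    then have "upcrossings a b X (Suc n) = Suc (upcrossings a b X n)"
      using that by (simp add: upcrossings_def)
    then show False
      using const[of n] const[of "Suc n"] that m by simp
  qed
  have hold: "holding a b X n" if "m \<le> n" for n
    using that
  proof (induction rule: dec_induct)
    case base
    show ?case using holding_if_less[where X=X, OF \<open>a < b\<close> m(2)] .
  next
    case (step n)
    then show ?case using no_sale[of n] by auto
  qed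
  \<comment> \<open>\<open>Suc m\<close> rather than \<open>m\<close>: the sale happens in the step
    from \<open>k - 1\<close> to \<open>k\<close>, and \<open>k - 1\<close> must still be at least
    \<open>m\<close>.\<close>
  obtain k where k: "Suc m \<le> k" "b < X k"
    using high by (auto simp: frequently_sequentially)
  then show False
    using no_sale[of "k - 1"] hold[of "k - 1"] by (cases k) auto
qed

text \<open>Levels strictly between a smaller liminf and a larger limsup would be crossed infinitely
  often. The hypothesis \<open>finite\<close> excludes divergence to infinity.\<close>

lemma convergent_if_upcrossings_bounded:
  fixes X :: "nat \<Rightarrow> real"
  assumes nonneg: "\<And>n. 0 \<le> X n"
    and bounded: "\<And>a b. a \<in> \<rat> \<Longrightarrow> b \<in> \<rat> \<Longrightarrow> 0 < a \<Longrightarrow> a < b \<Longrightarrow> \<exists>N. \<forall>n. upcrossings a b X n \<le> N"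
    and finite: "\<exists>\<^sub>F n in sequentially. X n \<le> K"
  shows "convergent X"
proof -
  let ?l = "liminf (\<lambda>n. ereal (X n))" and ?u = "limsup (\<lambda>n. ereal (X n))"
  have l0: "0 \<le> ?l"
    using nonneg by (intro Liminf_bounded) auto
  have "?l \<noteq> \<infinity>"
  proof
    assume "?l = \<infinity>"
    then have "eventually (\<lambda>n. ereal K < ereal (X n)) sequentially"
      using less_LiminfD[of "ereal K" sequentially "\<lambda>n. ereal (X n)"] by simp
    with finite show False
      by (simp add: frequently_def not_le)
  qed
  then obtain l where l: "?l = ereal l"
    using l0 by (cases ?l) auto
  have "?u \<le> ?l"
  proof (rule ccontr)
    assume "\<not> ?thesis"
    then have less: "?l < ?u" by simp
    \<comment> \<open>The limsup may be infinite, so real levels are inserted first and rational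
      ones are then found between reals.\<close>
    obtain a' where a': "?l < ereal a'" "ereal a' < ?u"
      using ereal_dense2[OF less] by auto
    obtain b' where b': "ereal a' < ereal b'" "ereal b' < ?u"
      using ereal_dense2[OF a'(2)] by auto
    obtain a where a: "a \<in> \<rat>" "l < a" "a < a'"
      using Rats_dense_in_real[of l a'] a' l by auto
    obtain b where b: "b \<in> \<rat>" "a' < b" "b < b'"
      using Rats_dense_in_real[of a' b'] b' by auto
    have "0 < a" using l0 l a by auto
    obtain N where N: "\<And>n. upcrossings a b X n \<le> N"
      using bounded[OF a(1) b(1) \<open>0 < a\<close>] a b by auto
    have "\<exists>\<^sub>F n in sequentially. X n < a"
    proof (rule ccontr)
      assume "\<not> ?thesis"
      then have "eventually (\<lambda>n. ereal a \<le> ereal (X n)) sequentially"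
        by (simp add: not_frequently not_less)
      then have "ereal a \<le> ?l" by (rule Liminf_bounded)
      then show False using a l by simp
    qed
    moreover have "\<exists>\<^sub>F n in sequentially. b < X n"
    proof (rule ccontr)
      assume "\<not> ?thesis"
      then have "eventually (\<lambda>n. ereal (X n) \<le> ereal b) sequentially"
        by (simp add: not_frequently not_less)
      then have "?u \<le> ereal b" by (rule Limsup_bounded)
      moreover have "ereal b < ereal b'" using b by simp
      ultimately show False using b'(2) by order
    qed
    ultimately obtain n where "N < upcrossings a b X n"
      using upcrossings_unbounded[of a b X N] a b by auto
    then show False using N[of n] by simp
  qed
  then have "?u = ?l"
    by (intro antisym Liminf_le_Limsup) auto
  then have "(\<lambda>n. ereal (X n)) \<longlonglongrightarrow> ereal l"
    using l by (simp add: tendsto_iff_Liminf_eq_Limsup del: lim_ereal)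
  then show ?thesis
    by (auto simp: convergent_def)
qed

section \<open>Convergence of nonnegative supermartingales\<close>

text \<open>The supermartingale property is given in integrated form over events of
  \<open>F n\<close>, which is how it is used and how \<open>recursion_on_set\<close> will supply
  it.\<close>

locale nonneg_supermartingale = finite_measure M
  for M :: "'a measure" +
  fixes F :: "nat \<Rightarrow> 'a measure" and X :: "nat \<Rightarrow> 'a \<Rightarrow> real"
  assumes subalg: "\<And>n. subalgebra M (F n)"
    and filtration: "\<And>m n. m \<le> n \<Longrightarrow> sets (F m) \<subseteq> sets (F n)"
    and adapted: "\<And>n. X n \<in> borel_measurable (F n)"
    and integrable: "\<And>n. integrable M (X n)"
    and nonneg: "\<And>n. AE x in M. 0 \<le> X n x"
    and decreasing: "\<And>n A. A \<in> sets (F n) \<Longrightarrow>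
      (\<integral>x. indicator A x * X (Suc n) x \<partial>M) \<le> (\<integral>x. indicator A x * X n x \<partial>M)"
begin

lemma space_F: "space (F n) = space M"
  using subalg[of n] by (simp add: subalgebra_def)

lemma measurable_mono_F: "m \<le> n \<Longrightarrow> f \<in> measurable (F m) N \<Longrightarrow> f \<in> measurable (F n) N"
  using filtration[of m n] by (auto simp: measurable_def space_F)

lemma measurable_X [measurable]: "X n \<in> borel_measurable M"
  using integrable[of n] by (rule borel_measurable_integrable)

text \<open>The decision at time \<open>n\<close> uses only prices up to \<open>n\<close>, so the
  strategy is predictable and \<open>decreasing\<close> applies to the event of holding.\<close>

lemma holding_sets_F: "{x \<in> space M. holding a b (\<lambda>n. X n x) n} \<in> sets (F n)"
proof -
  have "(\<lambda>x. holding a b (\<lambda>n. X n x) n) \<in> measurable (F n) (count_space UNIV)"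
  proof (induction n)
    case 0
    have [measurable]: "X 0 \<in> borel_measurable (F 0)" by (rule adapted)
    show ?case by simp
  next
    case (Suc n)
    have [measurable]: "X (Suc n) \<in> borel_measurable (F (Suc n))" by (rule adapted)
    have [measurable]: "(\<lambda>x. holding a b (\<lambda>n. X n x) n) \<in> measurable (F (Suc n)) (count_space UNIV)"
      using Suc by (rule measurable_mono_F[rotated]) simp
    show ?case by simp
  qed
  from measurable_sets[OF this, of "{True}"] show ?thesis
    by (simp add: vimage_def Int_def space_F conj_commute)
qed

lemma measurable_holding [measurable]: "Measurable.pred M (\<lambda>x. holding a b (\<lambda>n. X n x) n)"
  using holding_sets_F[of a b n] subalg[of n] by (auto simp: pred_def subalgebra_def)

lemma measurable_upcrossings [measurable]:
  "(\<lambda>x. real (upcrossings a b (\<lambda>n. X n x) n)) \<in> borel_measurable M"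
  unfolding upcrossings_def by measurable

lemma gain_eq: "x \<in> space M \<Longrightarrow> gain a b (\<lambda>n. X n x) n =
  (\<Sum>i<n. indicator {x \<in> space M. holding a b (\<lambda>n. X n x) i} x * X (Suc i) x
        - indicator {x \<in> space M. holding a b (\<lambda>n. X n x) i} x * X i x)"
  unfolding gain_def by (intro sum.cong) auto

lemma integrable_indicator_X: "A \<in> sets (F n) \<Longrightarrow> integrable M (\<lambda>x. indicator A x * X m x)"
  using integrable_mult_indicator[OF _ integrable, of A m] subalg[of n]
  by (auto simp: subalgebra_def)

lemma integrable_gain: "integrable M (\<lambda>x. gain a b (\<lambda>n. X n x) n)"
  by (subst Bochner_Integration.integrable_cong[OF refl gain_eq], assumption)
    (intro Bochner_Integration.integrable_sum Bochner_Integration.integrable_diff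
      integrable_indicator_X[OF holding_sets_F])

text \<open>A supermartingale cannot be beaten: the increment of step \<open>i\<close> is collected
  on an event of \<open>F i\<close>, where its mean is at most 0.\<close>

lemma integral_gain_le: "(\<integral>x. gain a b (\<lambda>n. X n x) n \<partial>M) \<le> 0"
proof -
  let ?A = "\<lambda>i. {x \<in> space M. holding a b (\<lambda>n. X n x) i}"
  have "(\<integral>x. gain a b (\<lambda>n. X n x) n \<partial>M) = (\<Sum>i<n.
      (\<integral>x. indicator (?A i) x * X (Suc i) x \<partial>M) - (\<integral>x. indicator (?A i) x * X i x \<partial>M))"
    by (subst Bochner_Integration.integral_cong[OF refl gain_eq], assumption,
        subst Bochner_Integration.integral_sum)
      (intro sum.cong Bochner_Integration.integral_diff Bochner_Integration.integrable_diff
        integrable_indicator_X[OF holding_sets_F] refl)+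
  also have "\<dots> \<le> 0"
    using decreasing[OF holding_sets_F] by (intro sum_nonpos) auto
  finally show ?thesis .
qed

text \<open>Doob's upcrossing inequality. Prices are nonnegative, so an open position costs at most
  \<open>a\<close> in \<open>gain_ge\<close>; integrating gives a bound uniform in
  \<open>n\<close>.\<close>

lemma integral_upcrossings_le:
  assumes "0 < a" "a < b"
  shows "(\<integral>\<^sup>+x. of_nat (upcrossings a b (\<lambda>n. X n x) n) \<partial>M)
    \<le> ennreal (a * measure M (space M) / (b - a))"
proof -
  let ?U = "\<lambda>x. real (upcrossings a b (\<lambda>n. X n x) n)"
  have le: "AE x in M. ?U x \<le> (gain a b (\<lambda>n. X n x) n + a) / (b - a)"
    using nonneg[of n]
  proof eventually_elim
    case (elim x)
    then show ?case
      using gain_ge[OF assms(2), of "\<lambda>n. X n x" n] assms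
      by (auto simp: field_simps split: if_splits)
  qed
  have int: "integrable M (\<lambda>x. (gain a b (\<lambda>n. X n x) n + a) / (b - a))"
    using integrable_gain by auto
  have "(\<integral>\<^sup>+x. of_nat (upcrossings a b (\<lambda>n. X n x) n) \<partial>M) = (\<integral>\<^sup>+x. ennreal (?U x) \<partial>M)"
    by (simp add: ennreal_of_nat_eq_real_of_nat)
  also have "\<dots> \<le> (\<integral>\<^sup>+x. ennreal ((gain a b (\<lambda>n. X n x) n + a) / (b - a)) \<partial>M)"
    using le by (intro nn_integral_mono_AE) (auto intro: ennreal_leI)
  also have "\<dots> = ennreal (\<integral>x. (gain a b (\<lambda>n. X n x) n + a) / (b - a) \<partial>M)"
    using le by (intro nn_integral_eq_integral[OF int])
      (auto elim!: eventually_mono intro: order_trans[rotated])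
  also have "(\<integral>x. (gain a b (\<lambda>n. X n x) n + a) / (b - a) \<partial>M)
      = ((\<integral>x. gain a b (\<lambda>n. X n x) n \<partial>M) + a * measure M (space M)) / (b - a)"
    using integrable_gain by simp
  also have "ennreal \<dots> \<le> ennreal (a * measure M (space M) / (b - a))"
    using integral_gain_le[of a b n] assms by (intro ennreal_leI divide_right_mono) auto
  finally show ?thesis .
qed

text \<open>By monotone convergence the uniform bound passes to the supremum over \<open>n\<close>,
  which is therefore almost everywhere finite.\<close>

lemma AE_upcrossings_bounded:
  assumes "0 < a" "a < b"
  shows "AE x in M. \<exists>N. \<forall>n. upcrossings a b (\<lambda>n. X n x) n \<le> N"
proof -
  let ?U = "\<lambda>n x. of_nat (upcrossings a b (\<lambda>n. X n x) n) :: ennreal"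
  have meas [measurable]: "?U n \<in> borel_measurable M" for n
    unfolding ennreal_of_nat_eq_real_of_nat by measurable
  have "(\<integral>\<^sup>+x. (SUP n. ?U n x) \<partial>M) = (SUP n. \<integral>\<^sup>+x. ?U n x \<partial>M)"
    using mono_upcrossings
    by (intro nn_integral_monotone_convergence_SUP) (auto simp: incseq_def le_fun_def mono_def)
  also have "\<dots> \<le> ennreal (a * measure M (space M) / (b - a))"
    by (intro SUP_least integral_upcrossings_le assms)
  also have "\<dots> < top" by simp
  finally have "AE x in M. (SUP n. ?U n x) \<noteq> \<infinity>"
    by (intro nn_integral_PInf_AE) auto
  then show ?thesis
  proof eventually_elim
    case (elim x)
    then obtain N where "(SUP n. ?U n x) < of_nat N"
      using ennreal_Ex_less_of_nat by (metis infinity_ennreal_def less_top)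
    then have "?U n x \<le> of_nat N" for n
      by (meson SUP_upper UNIV_I le_less_trans less_imp_le)
    then show ?case by auto
  qed
qed

lemma integral_le_initial: "(\<integral>x. X n x \<partial>M) \<le> (\<integral>x. X 0 x \<partial>M)"
proof (induction n)
  case (Suc n)
  have "(\<integral>x. X (Suc n) x \<partial>M) = (\<integral>x. indicator (space M) x * X (Suc n) x \<partial>M)"
    by (intro Bochner_Integration.integral_cong) auto
  also have "\<dots> \<le> (\<integral>x. indicator (space M) x * X n x \<partial>M)"
    using decreasing[OF sets.top[of "F n"]] by (simp add: space_F)
  also have "\<dots> = (\<integral>x. X n x \<partial>M)"
    by (intro Bochner_Integration.integral_cong) auto
  finally show ?case using Suc by simp
qed simp

text \<open>By Fatou's lemma the liminf has finite integral, hence is finite almost everywhere. This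
  supplies \<open>finite\<close> in the convergence criterion.\<close>

lemma AE_frequently_le: "AE x in M. \<exists>K. \<exists>\<^sub>F n in sequentially. X n x \<le> K"
proof -
  have "(\<integral>\<^sup>+x. liminf (\<lambda>n. ennreal (X n x)) \<partial>M) \<le> liminf (\<lambda>n. \<integral>\<^sup>+x. ennreal (X n x) \<partial>M)"
    by (intro nn_integral_liminf) auto
  also have "\<dots> \<le> ennreal (\<integral>x. X 0 x \<partial>M)"
    using nn_integral_eq_integral[OF integrable nonneg] integral_le_initial
    by (intro Liminf_le) (auto intro!: ennreal_leI always_eventually)
  also have "\<dots> < top" by simp
  finally have "AE x in M. liminf (\<lambda>n. ennreal (X n x)) \<noteq> \<infinity>"
    by (intro nn_integral_PInf_AE) auto
  then show ?thesis
  proof eventually_elim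
    case (elim x)
    then obtain K :: nat where K: "liminf (\<lambda>n. ennreal (X n x)) < of_nat K"
      using ennreal_Ex_less_of_nat by (metis infinity_ennreal_def less_top)
    have "\<exists>\<^sub>F n in sequentially. X n x \<le> real K"
    proof (rule ccontr)
      assume "\<not> ?thesis"
      then have "eventually (\<lambda>n. of_nat K \<le> ennreal (X n x)) sequentially"
        unfolding not_frequently not_le ennreal_of_nat_eq_real_of_nat
        by (auto elim!: eventually_mono intro!: ennreal_leI)
      then have "of_nat K \<le> liminf (\<lambda>n. ennreal (X n x))" by (rule Liminf_bounded)
      with K show False by simp
    qed
    then show ?case ..
  qed
qed

theorem AE_convergent: "AE x in M. convergent (\<lambda>n. X n x)"
proof -
  have 1: "AE x in M. \<forall>n. 0 \<le> X n x"
    using nonneg by (simp add: AE_all_countable)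
  \<comment> \<open>Rational levels keep the union of the exceptional null sets countable.\<close>
  have "AE x in M. \<forall>a\<in>\<rat>. \<forall>b\<in>\<rat>. 0 < a \<and> a < b \<longrightarrow> (\<exists>N. \<forall>n. upcrossings a b (\<lambda>n. X n x) n \<le> N)"
    using AE_upcrossings_bounded
    by (auto intro!: AE_ball_countable' countable_rat AE_impI)
  with 1 AE_frequently_le show ?thesis
  proof eventually_elim
    case (elim x)
    then obtain K where "\<exists>\<^sub>F n in sequentially. X n x \<le> K" by blast
    with elim show ?case
      by (intro convergent_if_upcrossings_bounded[where K=K]) auto
  qed
qed

end

section \<open>Second-order recursions\<close>

lemma convergent_affine_recursion:
  fixes x v :: "nat \<Rightarrow> real"
  assumes "0 < \<theta>" "\<theta> < 1" and rec: "\<And>n. x (Suc n) = \<theta> * x n + v n" and "convergent v"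
  shows "convergent x"
proof -
  obtain l where l: "v \<longlonglongrightarrow> l" using \<open>convergent v\<close> by (auto simp: convergent_def)
  \<comment> \<open>\<open>l / (1 - \<theta>)\<close> is the fixed point of the limiting recursion;
    the deviation from it is contracted by \<open>\<theta>\<close> up to a vanishing error.\<close>
  define y where "y n = x n - l / (1 - \<theta>)" for n
  have y_Suc: "y (Suc n) = \<theta> * y n + (v n - l)" for n
    using assms by (simp add: y_def rec divide_simps) (simp add: algebra_simps)
  have "y \<longlonglongrightarrow> 0"
  proof (rule LIMSEQ_I)
    fix e :: real assume "0 < e"
    \<comment> \<open>The tolerance is chosen so that
      \<open>\<theta> * (e / 2) + e * (1 - \<theta>) / 2 = e / 2\<close>, which makes the bound
      below stable under the recursion.\<close>
    obtain N where N: "\<And>n. N \<le> n \<Longrightarrow> \<bar>v n - l\<bar> < e * (1 - \<theta>) / 2"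
      using LIMSEQ_D[OF l, of "e * (1 - \<theta>) / 2"] \<open>0 < e\<close> assms by auto
    have bound: "\<bar>y (N + k)\<bar> \<le> \<theta> ^ k * \<bar>y N\<bar> + e / 2" for k
    proof (induction k)
      case (Suc k)
      have "\<bar>y (N + Suc k)\<bar> \<le> \<theta> * \<bar>y (N + k)\<bar> + \<bar>v (N + k) - l\<bar>"
        using y_Suc[of "N + k"] assms abs_triangle_ineq[of "\<theta> * y (N + k)" "v (N + k) - l"]
        by (simp add: abs_mult)
      also have "\<dots> \<le> \<theta> * (\<theta> ^ k * \<bar>y N\<bar> + e / 2) + e * (1 - \<theta>) / 2"
        using Suc N[of "N + k"] assms by (intro add_mono mult_left_mono) auto
      also have "\<dots> = \<theta> ^ Suc k * \<bar>y N\<bar> + e / 2"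
        by (simp add: field_simps)
      finally show ?case .
    qed (use \<open>0 < e\<close> in simp)
    have "(\<lambda>k. \<theta> ^ k * \<bar>y N\<bar>) \<longlonglongrightarrow> 0"
      using LIMSEQ_realpow_zero[of \<theta>] assms by (intro tendsto_mult_left_zero) auto
    then obtain K where K: "\<And>k. K \<le> k \<Longrightarrow> \<bar>\<theta> ^ k * \<bar>y N\<bar>\<bar> < e / 2"
      using LIMSEQ_D[of _ 0 "e / 2"] \<open>0 < e\<close> by fastforce
    show "\<exists>n0. \<forall>n\<ge>n0. norm (y n - 0) < e"
    proof (intro exI allI impI)
      fix n assume "N + K \<le> n"
      then have "N \<le> n" "K \<le> n - N" by auto
      then show "norm (y n - 0) < e"
        using bound[of "n - N"] K[of "n - N"] by (simp del: abs_mult)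
    qed
  qed
  then have "(\<lambda>n. y n + l / (1 - \<theta>)) \<longlonglongrightarrow> 0 + l / (1 - \<theta>)"
    by (intro tendsto_intros)
  then show ?thesis by (auto simp: y_def convergent_def)
qed

text \<open>The differences \<open>e (Suc n) - \<theta> * e n\<close> do not increase. If the first
  were negative, then \<open>\<theta> * e n \<le> e n\<close> would make \<open>e\<close> drop by at
  least its absolute value at each step, and so below 0. It is applied to means of \<open>r\<close>
  over an event.\<close>

lemma first_increment_ge:
  fixes e :: "nat \<Rightarrow> real"
  assumes "0 < \<theta>" "\<theta> < 1" and nonneg: "\<And>n. 0 \<le> e n"
    and rec: "\<And>n. e (Suc (Suc n)) \<le> (1 + \<theta>) * e (Suc n) - \<theta> * e n"
  shows "\<theta> * e 0 \<le> e 1"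
proof (rule ccontr)
  assume "\<not> ?thesis"
  then have neg: "e 1 - \<theta> * e 0 < 0" by simp
  have dec: "e (Suc n) - \<theta> * e n \<le> e 1 - \<theta> * e 0" for n
  proof (induction n)
    case (Suc n)
    then show ?case using rec[of n] by (simp add: algebra_simps)
  qed simp
  have le: "e (Suc n) \<le> e n + (e 1 - \<theta> * e 0)" for n
    using dec[of n] mult_right_mono[of \<theta> 1 "e n"] assms by simp
  have "e n \<le> e 0 + real n * (e 1 - \<theta> * e 0)" for n
  proof (induction n)
    case (Suc n)
    then show ?case using le[of n] by (simp add: algebra_simps)
  qed simp
  moreover obtain n :: nat where "e 0 < real n * - (e 1 - \<theta> * e 0)"
    using reals_Archimedean3[of "- (e 1 - \<theta> * e 0)"] neg by auto
  ultimately show False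
    using nonneg[of n] by (smt (verit) mult_minus_right)
qed

section \<open>Processes with a second-order conditional recursion\<close>

locale second_order_process = prob_space M
  for M :: "'a measure" +
  fixes F :: "nat \<Rightarrow> 'a measure" and r :: "nat \<Rightarrow> 'a \<Rightarrow> real" and \<theta> :: real
  assumes subalg: "\<And>n. subalgebra M (F n)"
    and filtration: "\<And>m n. m \<le> n \<Longrightarrow> sets (F m) \<subseteq> sets (F n)"
    and adapted: "\<And>n. r n \<in> borel_measurable (F n)"
    and nonneg: "\<And>n. AE x in M. 0 \<le> r n x"
    and \<theta>: "0 < \<theta>" "\<theta> < 1"
    and cond_exp_le: "\<And>n. AE x in M.
      enn2ereal (nn_cond_exp M (F (Suc n)) (\<lambda>y. ennreal (r (Suc (Suc n)) y)) x)
        \<le> ereal ((1 + \<theta>) * r (Suc n) x - \<theta> * r n x)"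
begin

lemma space_F: "space (F n) = space M"
  using subalg[of n] by (simp add: subalgebra_def)

lemma sets_F_M: "A \<in> sets (F n) \<Longrightarrow> A \<in> sets M"
  using subalg[of n] by (auto simp: subalgebra_def)

lemma adapted_mono: "m \<le> n \<Longrightarrow> r m \<in> borel_measurable (F n)"
  using filtration[of m n] adapted[of m] by (auto simp: measurable_def space_F)

lemma measurable_r [measurable]: "r n \<in> borel_measurable M"
  using measurable_from_subalg[OF subalg adapted] .

text \<open>Integrates the conditional inequality over \<open>A\<close>. As the right-hand side is
  finite, integrability on \<open>A\<close> passes to the next term.\<close>

lemma recursion_on_set:
  assumes A: "A \<in> sets (F (Suc n))"
    and int0: "integrable M (\<lambda>x. indicator A x * r n x)"
    and int1: "integrable M (\<lambda>x. indicator A x * r (Suc n) x)"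
  shows "integrable M (\<lambda>x. indicator A x * r (Suc (Suc n)) x)" (is ?int)
    and "(\<integral>x. indicator A x * r (Suc (Suc n)) x \<partial>M)
      \<le> (1 + \<theta>) * (\<integral>x. indicator A x * r (Suc n) x \<partial>M) - \<theta> * (\<integral>x. indicator A x * r n x \<partial>M)"
      (is ?le)
proof -
  interpret sub: sigma_finite_subalgebra M "F (Suc n)"
    by (intro finite_measure_subalgebra_is_sigma_finite) (unfold_locales, rule subalg)
  let ?c = "nn_cond_exp M (F (Suc n)) (\<lambda>y. ennreal (r (Suc (Suc n)) y))"
  let ?s = "\<lambda>x. (1 + \<theta>) * (indicator A x * r (Suc n) x) - \<theta> * (indicator A x * r n x)"
  have [measurable]: "A \<in> sets M" using A by (rule sets_F_M)
  have s_int: "integrable M ?s" using int0 int1 by auto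
  \<comment> \<open>The real bound dominates a nonnegative conditional expectation, so it is itself
    nonnegative and \<open>ennreal\<close> does not truncate it.\<close>
  have bound: "AE x in M. indicator A x * ?c x \<le> ennreal (?s x) \<and> 0 \<le> ?s x"
    using cond_exp_le[of n]
  proof eventually_elim
    case (elim x)
    have "0 \<le> enn2ereal (?c x)" by simp
    with elim have pos: "0 \<le> (1 + \<theta>) * r (Suc n) x - \<theta> * r n x"
      by (metis ereal_less_eq(5) order_trans)
    have "?c x \<le> ennreal ((1 + \<theta>) * r (Suc n) x - \<theta> * r n x)"
      using elim pos by (simp add: less_eq_ennreal.rep_eq)
    with pos show ?case by (auto simp: indicator_def)
  qed
  have "(\<integral>\<^sup>+x. ennreal (indicator A x * r (Suc (Suc n)) x) \<partial>M)
      = (\<integral>\<^sup>+x. indicator A x * ennreal (r (Suc (Suc n)) x) \<partial>M)"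
    by (intro nn_integral_cong) (auto simp: indicator_def)
  also have "\<dots> = (\<integral>\<^sup>+x. indicator A x * ?c x \<partial>M)"
    using A by (intro sub.nn_cond_exp_intg[symmetric]) auto
  also have "\<dots> \<le> (\<integral>\<^sup>+x. ennreal (?s x) \<partial>M)"
    using bound by (intro nn_integral_mono_AE) auto
  also have "\<dots> = ennreal (\<integral>x. ?s x \<partial>M)"
    using bound by (intro nn_integral_eq_integral s_int) auto
  finally have le: "(\<integral>\<^sup>+x. ennreal (indicator A x * r (Suc (Suc n)) x) \<partial>M) \<le> ennreal (\<integral>x. ?s x \<partial>M)" .
  have pos: "AE x in M. 0 \<le> indicator A x * r (Suc (Suc n)) x"
    using nonneg[of "Suc (Suc n)"] by eventually_elim auto
  show int: ?int
    using le pos by (intro integrableI_nonneg) (auto intro: le_less_trans)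
  \<comment> \<open>Nonnegativity allows \<open>ennreal\<close> to be cancelled in
    \<open>le\<close>.\<close>
  have "0 \<le> (\<integral>x. ?s x \<partial>M)"
    using bound by (intro integral_nonneg_AE) auto
  then have "(\<integral>x. indicator A x * r (Suc (Suc n)) x \<partial>M) \<le> (\<integral>x. ?s x \<partial>M)"
    using le by (simp add: nn_integral_eq_integral[OF int pos])
  also have "\<dots> = (1 + \<theta>) * (\<integral>x. indicator A x * r (Suc n) x \<partial>M) - \<theta> * (\<integral>x. indicator A x * r n x \<partial>M)"
    using int0 int1 by simp
  finally show ?le .
qed

text \<open>The recursion has order two, so the induction carries integrability of two consecutive
  terms; \<open>A\<close> stays in the later sigma-algebras.\<close>

lemma integrable_on_set:
  assumes "A \<in> sets (F (Suc n))"
    and "integrable M (\<lambda>x. indicator A x * r n x)"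
    and "integrable M (\<lambda>x. indicator A x * r (Suc n) x)"
  shows "integrable M (\<lambda>x. indicator A x * r (n + k) x)"
proof -
  have "integrable M (\<lambda>x. indicator A x * r (n + k) x) \<and>
      integrable M (\<lambda>x. indicator A x * r (Suc (n + k)) x)"
  proof (induction k)
    case (Suc k)
    moreover have "A \<in> sets (F (Suc (n + k)))"
      using assms(1) filtration[of "Suc n" "Suc (n + k)"] by auto
    ultimately show ?case using recursion_on_set(1)[of A "n + k"] by simp
  qed (use assms in simp)
  then show ?thesis ..
qed

lemma integrable_bounded_on:
  assumes "A \<in> sets M" "\<And>x. x \<in> A \<Longrightarrow> r n x \<le> K"
  shows "integrable M (\<lambda>x. indicator A x * r n x)"
  using nonneg[of n] assms
  by (intro integrable_const_bound[of _ "\<bar>K\<bar>"])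
    (auto simp: indicator_def elim!: eventually_mono intro: order_trans[OF _ abs_ge_self])

text \<open>The means of the process over the bad event satisfy \<open>first_increment_ge\<close>,
  so that event is null. Cutting it at \<open>r n \<le> K\<close> makes the means finite, and
  countably many \<open>K\<close> suffice.\<close>

lemma AE_increment_nonneg: "AE x in M. \<theta> * r n x \<le> r (Suc n) x"
proof -
  have "AE x in M. r n x \<le> real K \<longrightarrow> \<theta> * r n x \<le> r (Suc n) x" for K :: nat
  proof -
    define A where "A = {x \<in> space M. r n x \<le> real K \<and> r (Suc n) x < \<theta> * r n x}"
    have [measurable]: "r n \<in> borel_measurable (F (Suc n))" "r (Suc n) \<in> borel_measurable (F (Suc n))"
      by (rule adapted_mono, simp)+
    have "{x \<in> space (F (Suc n)). r n x \<le> real K \<and> r (Suc n) x < \<theta> * r n x} \<in> sets (F (Suc n))"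
      by measurable
    then have A: "A \<in> sets (F (Suc n))"
      by (simp add: A_def space_F)
    then have [measurable]: "A \<in> sets M" by (rule sets_F_M)
    have int0: "integrable M (\<lambda>x. indicator A x * r n x)"
      by (rule integrable_bounded_on[where K=K]) (auto simp: A_def)
    have int1: "integrable M (\<lambda>x. indicator A x * r (Suc n) x)"
    \<comment> \<open>On the bad event the bound on \<open>r n\<close> also bounds
      \<open>r (Suc n)\<close>.\<close>
    proof (rule integrable_bounded_on[where K="\<theta> * K"])
      fix x assume "x \<in> A"
      then have "r n x \<le> real K" "r (Suc n) x < \<theta> * r n x" by (auto simp: A_def)
      moreover from this(1) have "\<theta> * r n x \<le> \<theta> * real K"
        using \<theta> by (intro mult_left_mono) auto
      ultimately show "r (Suc n) x \<le> \<theta> * real K" by linarith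
    qed simp
    note int = integrable_on_set[OF A int0 int1]
    define e where "e k = (\<integral>x. indicator A x * r (n + k) x \<partial>M)" for k
    have "\<theta> * e 0 \<le> e 1"
    proof (rule first_increment_ge[OF \<theta>])
      show "0 \<le> e k" for k
        unfolding e_def using nonneg[of "n + k"] by (intro integral_nonneg_AE) auto
      show "e (Suc (Suc k)) \<le> (1 + \<theta>) * e (Suc k) - \<theta> * e k" for k
        using recursion_on_set(2)[of A "n + k"] int[of k] int[of "Suc k"]
          A filtration[of "Suc n" "Suc (n + k)"]
        by (auto simp: e_def)
    qed
    then have le: "(\<integral>x. indicator A x * (\<theta> * r n x - r (Suc n) x) \<partial>M) \<le> 0"
      using int0 int1 by (simp add: e_def algebra_simps)
    have pos: "AE x in M. 0 \<le> indicator A x * (\<theta> * r n x - r (Suc n) x)"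
      by (auto simp: A_def indicator_def)
    have "integrable M (\<lambda>x. indicator A x * (\<theta> * r n x - r (Suc n) x))"
      using Bochner_Integration.integrable_diff[OF integrable_mult_right[OF int0, of \<theta>] int1]
      by (simp add: algebra_simps)
    \<comment> \<open>A nonnegative integrand with integral at most 0 vanishes almost everywhere,
      but this one is strictly positive on \<open>A\<close>.\<close>
    from integral_nonneg_eq_0_iff_AE[OF this pos] le integral_nonneg_AE[OF pos]
    have "AE x in M. indicator A x * (\<theta> * r n x - r (Suc n) x) = 0" by simp
    then show ?thesis
      using AE_space by eventually_elim (auto simp: A_def indicator_def split: if_splits)
  qed
  then have "AE x in M. \<forall>K::nat. r n x \<le> real K \<longrightarrow> \<theta> * r n x \<le> r (Suc n) x"
    unfolding AE_all_countable by blast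
  then show ?thesis
    by eventually_elim (metis real_arch_simple)
qed

text \<open>The event \<open>A\<close> is known at time 1, so multiplying by its indicator preserves
  the recursion while making every term integrable.\<close>

lemma AE_convergent_if_bounded: "AE x in M. r 0 x \<le> K \<and> r 1 x \<le> K \<longrightarrow> convergent (\<lambda>n. r n x)"
proof -
  define A where "A = {x \<in> space M. r 0 x \<le> K \<and> r 1 x \<le> K}"
  have [measurable]: "r 0 \<in> borel_measurable (F 1)" "r 1 \<in> borel_measurable (F 1)"
    by (rule adapted_mono, simp)+
  have "{x \<in> space (F 1). r 0 x \<le> K \<and> r 1 x \<le> K} \<in> sets (F 1)"
    by measurable
  then have A1: "A \<in> sets (F 1)" by (simp add: A_def space_F)
  then have A: "A \<in> sets (F (Suc n))" for n
    using filtration[of 1 "Suc n"] by auto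
  have [measurable]: "A \<in> sets M" using A1 by (rule sets_F_M)
  have int: "integrable M (\<lambda>x. indicator A x * r k x)" for k
  proof -
    have "integrable M (\<lambda>x. indicator A x * r 0 x)" "integrable M (\<lambda>x. indicator A x * r 1 x)"
      by (rule integrable_bounded_on[where K=K]; simp add: A_def)+
    with integrable_on_set[OF A[of 0], of k] show ?thesis by simp
  qed
  define V where "V n x = indicator A x * r (Suc n) x - \<theta> * (indicator A x * r n x)" for n x
  \<comment> \<open>The filtration is shifted by one because \<open>V n\<close> involves
    \<open>r (Suc n)\<close>.\<close>
  interpret V: nonneg_supermartingale M "\<lambda>n. F (Suc n)" V
  proof
    show "subalgebra M (F (Suc n))" for n by (rule subalg)
    show "sets (F (Suc m)) \<subseteq> sets (F (Suc n))" if "m \<le> n" for m n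
      using that by (intro filtration) simp
    fix n
    have [measurable]: "r n \<in> borel_measurable (F (Suc n))"
      "r (Suc n) \<in> borel_measurable (F (Suc n))" "A \<in> sets (F (Suc n))"
      by (rule adapted_mono, simp)+ (rule A)
    show "V n \<in> borel_measurable (F (Suc n))"
      unfolding V_def by measurable
    show "integrable M (V n)"
      unfolding V_def using int by auto
    show "AE x in M. 0 \<le> V n x"
      using AE_increment_nonneg[of n] by eventually_elim (auto simp: V_def indicator_def)
    fix B assume B: "B \<in> sets (F (Suc n))"
    then have "B \<in> sets M" by (rule sets_F_M)
    have int': "integrable M (\<lambda>x. indicator (B \<inter> A) x * r k x)" for k
      using integrable_mult_indicator[OF \<open>B \<in> sets M\<close> int[of k]]
      by (simp add: indicator_inter_arith mult.assoc)
    have V: "(\<integral>x. indicator B x * V k x \<partial>M) = (\<integral>x. indicator (B \<inter> A) x * r (Suc k) x \<partial>M)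
        - \<theta> * (\<integral>x. indicator (B \<inter> A) x * r k x \<partial>M)" for k
    proof -
      have "(\<integral>x. indicator B x * V k x \<partial>M) = (\<integral>x. indicator (B \<inter> A) x * r (Suc k) x
          - \<theta> * (indicator (B \<inter> A) x * r k x) \<partial>M)"
        by (intro Bochner_Integration.integral_cong) (auto simp: V_def indicator_def)
      then show ?thesis using int' by simp
    qed
    \<comment> \<open>Subtracting \<open>\<theta>\<close> times the middle mean from both sides of
      the recursion over \<open>B \<inter> A\<close> gives exactly this inequality.\<close>
    show "(\<integral>x. indicator B x * V (Suc n) x \<partial>M) \<le> (\<integral>x. indicator B x * V n x \<partial>M)"
      using recursion_on_set(2)[of "B \<inter> A" n, OF _ int' int'] A B
      unfolding V by (simp add: algebra_simps sets.Int)
  qed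
  show ?thesis
    using V.AE_convergent AE_space
  proof eventually_elim
    case (elim x)
    show ?case
    proof
      \<comment> \<open>On \<open>A\<close> the indicator is 1, so \<open>V\<close> is the forcing
        term of the affine recursion for \<open>r\<close>.\<close>
      assume "r 0 x \<le> K \<and> r 1 x \<le> K"
      with elim(2) have "r (Suc n) x = \<theta> * r n x + V n x" for n
        by (simp add: V_def A_def)
      then show "convergent (\<lambda>n. r n x)"
        using elim(1) by (rule convergent_affine_recursion[OF \<theta>])
    qed
  qed
qed

lemma AE_convergent: "AE x in M. convergent (\<lambda>n. r n x)"
proof -
  have "AE x in M. \<forall>K::nat. r 0 x \<le> real K \<and> r 1 x \<le> real K \<longrightarrow> convergent (\<lambda>n. r n x)"
    unfolding AE_all_countable using AE_convergent_if_bounded by blast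
  then show ?thesis
  proof eventually_elim
    case (elim x)
    obtain K :: nat where "max (r 0 x) (r 1 x) \<le> real K"
      using real_arch_simple by blast
    then show ?case using elim by auto
  qed
qed

end

section \<open>A measurable limit for the process indexed from 1\<close>

theorem lemma7:
  fixes M :: "'a measure"
    and F :: "nat \<Rightarrow> 'a measure"
    and r :: "nat \<Rightarrow> 'a \<Rightarrow> real"
    and \<theta> :: real
  assumes "prob_space M"
    and "\<And>n. 1 \<le> n \<Longrightarrow> subalgebra M (F n)"
    and "\<And>m n. 1 \<le> m \<Longrightarrow> m \<le> n \<Longrightarrow> sets (F m) \<subseteq> sets (F n)"
    and "\<And>n. 1 \<le> n \<Longrightarrow> r n \<in> borel_measurable (F n)"
    and "\<And>n. 1 \<le> n \<Longrightarrow> AE x in M. 0 \<le> r n x"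
    and "0 < \<theta>" and "\<theta> < 1"
    and "\<And>n. 1 \<le> n \<Longrightarrow>
      AE x in M. enn2ereal (nn_cond_exp M (F (n + 1)) (\<lambda>y. ennreal (r (n + 2) y)) x)
                   \<le> ereal ((1 + \<theta>) * r (n + 1) x - \<theta> * r n x)"
  shows "\<exists>r_inf :: 'a \<Rightarrow> real. r_inf \<in> borel_measurable M \<and>
           (AE x in M. (\<lambda>n. r n x) \<longlonglongrightarrow> r_inf x)"
proof -
  interpret prob_space M by fact
  interpret second_order_process M "\<lambda>n. F (Suc n)" "\<lambda>n. r (Suc n)" \<theta>
  proof
    fix n
    show "AE x in M. enn2ereal
        (nn_cond_exp M (F (Suc (Suc n))) (\<lambda>y. ennreal (r (Suc (Suc (Suc n))) y)) x)
          \<le> ereal ((1 + \<theta>) * r (Suc (Suc n)) x - \<theta> * r (Suc n) x)"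
      using assms(8)[of "Suc n"] by simp
  qed (use assms in auto)
  show ?thesis
  proof (intro exI conjI)
    \<comment> \<open>Where the sequence diverges, \<open>lim\<close> is one unspecified constant,
      so this witness is measurable on the whole space.\<close>
    show "(\<lambda>x. lim (\<lambda>n. r (Suc n) x)) \<in> borel_measurable M"
      by (intro borel_measurable_lim_metric measurable_r)
    show "AE x in M. (\<lambda>n. r n x) \<longlonglongrightarrow> lim (\<lambda>n. r (Suc n) x)"
      using AE_convergent
    proof eventually_elim
      case (elim x)
      then have "(\<lambda>n. r (Suc n) x) \<longlonglongrightarrow> lim (\<lambda>n. r (Suc n) x)"
        by (simp add: convergent_LIMSEQ_iff)
      then show ?case by (rule LIMSEQ_imp_Suc)
    qed
  qed
qed

end
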